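(* Let $N\geq 2$ and $2\leq p<q<+\infty$. Then for any positive constant $\tilde a$, there are infinitely many positive constants $\tilde b$ such that the semilinear elliptic equation $$-\Delta u+\tilde a|u|^{p-2}u-\tilde b|u|^{q-2}u=0$$ on the lattice graph $\mathbb{Z}^N$ has at least one positive solution $u\in\mathcal{E}_{p,q}$.
   Context: The lattice graph $\mathbb{Z}^N$ has vertex set $\mathbb{Z}^N$ and edges $x\sim y$ iff $\sum_{i=1}^N|x_i-y_i|=1$. For $u:\mathbb{Z}^N\to\mathbb{R}$, the Laplacian is $\Delta u(x)=\sum_{y\sim x}(u(y)-u(x))$ and the length of the gradient is $|\nabla u|(x)=\big(\frac12\sum_{y\sim x}(u(y)-u(x))^2\big)^{1/2}$. For $1\le s<\infty$, $\|f\|_s=(\sum_{x\in\mathbb{Z}^N}|f(x)|^s)^{1/s}$, and $\|\nabla u\|_2$ denotes $\||\nabla u|\|_2$. The space $\mathcal{E}_{p,q}$ is the completion of the finitely supported functions $C_c(\mathbb{Z}^N)$ with respect to the norm $\|u\|_{\mathcal{E}_{p,q}}=\|\nabla u\|_2+\|u\|_p+\|u\|_q$ (a space of functions on $\mathbb{Z}^N$). A solution is positive if $u(x)>0$ for every $x\in\mathbb{Z}^N$. *)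

theory Defs
  imports "HOL-Analysis.Analysis"
begin

text \<open>The vertex set of the lattice graph is the type \<open>int ^ 'n\<close>, with dimension \<open>CARD('n)\<close>.\<close>

definition adj :: "int ^ 'n \<Rightarrow> int ^ 'n \<Rightarrow> bool" where
  "adj x y \<longleftrightarrow> (\<Sum>i\<in>UNIV. \<bar>x $ i - y $ i\<bar>) = 1"

text \<open>So the sums over neighbours below are genuine finite sums.\<close>

lemma finite_adj: "finite {y. adj x y}"
proof -
  have "y $ i \<in> {x $ i - 1..x $ i + 1}" if "adj x y" for y i
  proof -
    have "\<bar>x $ i - y $ i\<bar> \<le> (\<Sum>i\<in>UNIV. \<bar>x $ i - y $ i\<bar>)"
      by (rule member_le_sum) auto
    then show ?thesis
      using that by (auto simp: adj_def)
  qed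
  then have "($) ` {y. adj x y} \<subseteq> (\<Pi>\<^sub>E i\<in>UNIV. {x $ i - 1..x $ i + 1})"
    by (auto simp: PiE_def Pi_def)
  moreover have "finite (\<Pi>\<^sub>E i\<in>UNIV. {x $ i - 1..x $ i + 1})"
    by (intro finite_PiE) auto
  ultimately have "finite (($) ` {y. adj x y})"
    by (rule finite_subset)
  moreover have "inj_on ($) {y. adj x y}"
    by (auto simp: inj_on_def vec_eq_iff)
  ultimately show ?thesis
    by (rule finite_imageD)
qed

definition laplacian :: "(int ^ 'n \<Rightarrow> real) \<Rightarrow> int ^ 'n \<Rightarrow> real" where
  "laplacian u x = (\<Sum>y | adj x y. u y - u x)"

definition grad_length :: "(int ^ 'n \<Rightarrow> real) \<Rightarrow> int ^ 'n \<Rightarrow> real" where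
  "grad_length u x = sqrt (1 / 2 * (\<Sum>y | adj x y. (u y - u x)\<^sup>2))"

text \<open>\<^const>\<open>infsum\<close> returns 0 for divergent sums, so \<open>ell_norm s f\<close> is the norm of \<open>f\<close> only
  if the sum converges. Below it is applied to finitely supported functions only.\<close>

definition ell_norm :: "real \<Rightarrow> (int ^ 'n \<Rightarrow> real) \<Rightarrow> real" where
  "ell_norm s f = (\<Sum>\<^sub>\<infinity>x. \<bar>f x\<bar> powr s) powr (1 / s)"

definition E_norm :: "real \<Rightarrow> real \<Rightarrow> (int ^ 'n \<Rightarrow> real) \<Rightarrow> real" where
  "E_norm p q u = ell_norm 2 (grad_length u) + ell_norm p u + ell_norm q u"

definition finitely_supported :: "(int ^ 'n \<Rightarrow> real) \<Rightarrow> bool" where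
  "finitely_supported u \<longleftrightarrow> finite {x. u x \<noteq> 0}"

text \<open>The completion of the finitely supported functions, as a space of functions: the element
  given by an \<open>E_norm\<close>-Cauchy sequence is identified with the pointwise limit of the sequence.
  The limit exists since \<open>\<bar>u x\<bar> \<le> ell_norm p u\<close> for finitely supported \<open>u\<close>, and by Fatou's
  lemma two Cauchy sequences with the same pointwise limit are equivalent.\<close>

definition E_space :: "real \<Rightarrow> real \<Rightarrow> (int ^ 'n \<Rightarrow> real) set" where
  "E_space p q = {u. \<exists>\<phi> :: nat \<Rightarrow> int ^ 'n \<Rightarrow> real.
     (\<forall>k. finitely_supported (\<phi> k)) \<and>
     (\<forall>\<epsilon>>0. \<exists>M. \<forall>m\<ge>M. \<forall>n\<ge>M. E_norm p q (\<lambda>x. \<phi> m x - \<phi> n x) < \<epsilon>) \<and>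
     (\<forall>x. (\<lambda>k. \<phi> k x) \<longlonglongrightarrow> u x)}"

text \<open>In the case \<open>p = 2\<close>, the convention \<open>0 powr 0 = 0\<close> does no harm, because of the factor \<open>u x\<close>.\<close>

definition is_solution :: "real \<Rightarrow> real \<Rightarrow> real \<Rightarrow> real \<Rightarrow> (int ^ 'n \<Rightarrow> real) \<Rightarrow> bool" where
  "is_solution p q a b u \<longleftrightarrow>
     (\<forall>x. - laplacian u x + a * \<bar>u x\<bar> powr (p - 2) * u x - b * \<bar>u x\<bar> powr (q - 2) * u x = 0)"

end

theory Submission
  imports Defs "HOL-Complex_Analysis.Great_Picard"
begin

text \<open>Minimise the functional
  \<open>J u = \<parallel>\<nabla>u\<parallel>\<^sub>2\<^sup>2 / 2 + (a / p) \<parallel>u\<parallel>\<^sub>p\<^sup>p - k \<parallel>u\<parallel>\<^sub>q\<close>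
  over the finitely supported functions. Since \<open>\<parallel>u\<parallel>\<^sub>q \<le> \<parallel>u\<parallel>\<^sub>p\<close> and the last term has degree one, \<open>J\<close> is
  bounded from below and its infimum is negative. Along a minimising sequence \<open>\<parallel>u\<parallel>\<^sub>q\<close> stays away
  from 0 while \<open>\<parallel>u\<parallel>\<^sub>p\<close> is bounded, so the suprema stay away from 0. After taking absolute values and
  translating the peaks to the origin, a subsequence converges pointwise to some \<open>U \<noteq> 0\<close>,
  and \<open>\<parallel>u\<parallel>\<^sub>q\<^sup>q\<close> converges to some \<open>G > 0\<close>. It is not needed that \<open>U\<close> attains the infimum: the change of \<open>J\<close>
  under the perturbation of one value depends only on the nearby values and on \<open>\<parallel>u\<parallel>\<^sub>q\<close>, so it passes
  to the limit and is nonnegative there. This gives the strong maximum principle and the equation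
  for \<open>U\<close> with \<open>b = k G\<^bsup>1/q - 1\<^esup>\<close>, which is large if \<open>k\<close> is small.\<close>

section \<open>Adjacency in the lattice and its connectedness\<close>

lemma adj_commute: "adj x y \<longleftrightarrow> adj y x"
  by (simp add: adj_def abs_minus_commute)

lemma not_adj_self [simp]: "\<not> adj x x"
  by (simp add: adj_def)

text \<open>Moving a nonzero coordinate one unit towards 0 gives a neighbour of smaller l1 norm, so
  induction on this norm applies. In this form the lemma spreads positivity from the origin to every
  vertex.\<close>

lemma adj_connected:
  fixes P :: "int ^ 'n \<Rightarrow> bool"
  assumes step: "\<And>x y. P x \<Longrightarrow> adj x y \<Longrightarrow> P y" and base: "P 0"
  shows "P x"
proof (induction "nat (\<Sum>i\<in>UNIV. \<bar>x $ i\<bar>)" arbitrary: x rule: less_induct)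
  case less
  show ?case
  proof (cases "x = 0")
    case False
    then obtain i where i: "x $ i \<noteq> 0"
      by (auto simp: vec_eq_iff)
    define y :: "int ^ 'n" where "y = (\<chi> j. if j = i then x $ i - sgn (x $ i) else x $ j)"
    have s: "\<bar>x $ i - sgn (x $ i)\<bar> = \<bar>x $ i\<bar> - 1"
      using i by (auto simp: sgn_if)
    have "(\<Sum>j\<in>UNIV. \<bar>y $ j\<bar>) = (\<Sum>j\<in>UNIV. \<bar>x $ j\<bar> - (if j = i then 1 else 0))"
      by (rule sum.cong) (auto simp: y_def s)
    also have "\<dots> = (\<Sum>j\<in>UNIV. \<bar>x $ j\<bar>) - 1"
      by (simp add: sum_subtractf)
    finally have "(\<Sum>j\<in>UNIV. \<bar>y $ j\<bar>) = (\<Sum>j\<in>UNIV. \<bar>x $ j\<bar>) - 1" .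
    moreover have "(\<Sum>j\<in>UNIV. \<bar>y $ j\<bar>) \<ge> 0"
      by (simp add: sum_nonneg)
    ultimately have "P y"
      by (intro less) auto
    moreover have "(\<Sum>j\<in>UNIV. \<bar>y $ j - x $ j\<bar>) = (\<Sum>j\<in>UNIV. if j = i then 1 else 0)"
      by (rule sum.cong) (use i in \<open>auto simp: y_def sgn_if\<close>)
    then have "adj y x"
      by (simp add: adj_def)
    ultimately show ?thesis
      by (rule step)
  qed (use base in simp)
qed

section \<open>The energy of finitely supported functions and its change under updates\<close>

definition pow_sum :: "real \<Rightarrow> (int ^ 'n \<Rightarrow> real) \<Rightarrow> real" where
  "pow_sum s u = (\<Sum>\<^sub>\<infinity>x. \<bar>u x\<bar> powr s)"

text \<open>Every edge is counted twice, so \<open>dirichlet u\<close> is \<open>2 \<parallel>\<nabla>u\<parallel>\<^sub>2\<^sup>2\<close>.\<close>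

definition dirichlet :: "(int ^ 'n \<Rightarrow> real) \<Rightarrow> real" where
  "dirichlet u = (\<Sum>\<^sub>\<infinity>e\<in>{(x, y). adj x y}. (u (snd e) - u (fst e))\<^sup>2)"

text \<open>This is the functional \<open>J\<close> of the overview; the weight 1/4 absorbs the
  factor 2 in \<open>dirichlet\<close>.\<close>

definition energy :: "real \<Rightarrow> real \<Rightarrow> real \<Rightarrow> real \<Rightarrow> (int ^ 'n \<Rightarrow> real) \<Rightarrow> real" where
  "energy p q a k u = dirichlet u / 4 + a / p * pow_sum p u - k * pow_sum q u powr (1 / q)"

lemma finitely_supported_update:
  assumes "finitely_supported u"
  shows "finitely_supported (u(z := t))"
proof -
  have "{x. (u(z := t)) x \<noteq> 0} \<subseteq> insert z {x. u x \<noteq> 0}"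
    by auto
  then show ?thesis
    using assms unfolding finitely_supported_def by (meson finite_insert finite_subset)
qed

lemma summable_pow_finitely_supported:
  assumes "finitely_supported u"
  shows "(\<lambda>x. \<bar>u x\<bar> powr s) summable_on UNIV"
  using assms by (intro finite_nonzero_values_imp_summable_on) (auto simp: finitely_supported_def)

lemma summable_dirichlet_finitely_supported:
  fixes u :: "int ^ 'n \<Rightarrow> real"
  assumes "finitely_supported u"
  shows "(\<lambda>e. (u (snd e) - u (fst e))\<^sup>2) summable_on {(x, y). adj x y}"
proof (rule finite_nonzero_values_imp_summable_on)
  \<comment> \<open>An edge with a nonzero term starts or ends in the support; the swapped copy
    covers those that end there.\<close>
  let ?S = "Sigma {x. u x \<noteq> 0} (\<lambda>x. {y. adj x y})"
  have "{e \<in> {(x, y). adj x y}. (u (snd e) - u (fst e))\<^sup>2 \<noteq> 0} \<subseteq> ?S \<union> prod.swap ` ?S"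
    by (auto simp: image_iff adj_commute)
  moreover have "finite ?S"
    using assms by (intro finite_SigmaI finite_adj) (simp add: finitely_supported_def)
  ultimately show "finite {e \<in> {(x, y). adj x y}. (u (snd e) - u (fst e))\<^sup>2 \<noteq> 0}"
    by (meson finite_UnI finite_imageI finite_subset)
qed

text \<open>It turns the effect of a local change on an infinite sum into an exact finite
  expression.\<close>

lemma infsum_finite_change:
  fixes f g :: "'a \<Rightarrow> real"
  assumes "f summable_on A" "g summable_on A" "finite F" "F \<subseteq> A" "\<And>x. x \<in> A - F \<Longrightarrow> f x = g x"
  shows "infsum f A = infsum g A + (\<Sum>x\<in>F. f x - g x)"
proof -
  have "infsum f A - infsum g A = (\<Sum>\<^sub>\<infinity>x\<in>A. f x - g x)"
    using assms(1,2) infsum_add[of f A "\<lambda>x. - g x"]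
    by (simp add: infsum_uminus summable_on_uminus)
  also have "\<dots> = (\<Sum>\<^sub>\<infinity>x\<in>F. f x - g x)"
    using assms by (intro infsum_cong_neutral) auto
  finally show ?thesis
    using assms by simp
qed

lemma pow_sum_update:
  assumes "finitely_supported u"
  shows "pow_sum s (u(z := t)) = pow_sum s u + \<bar>t\<bar> powr s - \<bar>u z\<bar> powr s"
  unfolding pow_sum_def
  by (subst infsum_finite_change[where g = "\<lambda>x. \<bar>u x\<bar> powr s" and F = "{z}"])
     (use assms in \<open>auto simp: summable_pow_finitely_supported finitely_supported_update
        simp del: fun_upd_apply\<close>, simp_all)

text \<open>Only the edges at \<open>z\<close> change. Each occurs in both orientations with the
  same contribution, hence the factor 2; the two families are disjoint because \<open>z\<close> is
  not adjacent to itself.\<close>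

lemma dirichlet_update:
  fixes u :: "int ^ 'n \<Rightarrow> real"
  assumes "finitely_supported u"
  shows "dirichlet (u(z := u z + t)) =
    dirichlet u + 2 * (\<Sum>y | adj z y. t\<^sup>2 - 2 * t * (u y - u z))"
proof -
  let ?v = "u(z := u z + t)" and ?N = "{y. adj z y}"
  let ?d = "\<lambda>e. (?v (snd e) - ?v (fst e))\<^sup>2 - (u (snd e) - u (fst e))\<^sup>2"
  have d: "(?v y - ?v z)\<^sup>2 - (u y - u z)\<^sup>2 = t\<^sup>2 - 2 * t * (u y - u z)"
      "(?v z - ?v y)\<^sup>2 - (u z - u y)\<^sup>2 = t\<^sup>2 - 2 * t * (u y - u z)"
    if "adj z y" for y
    using that by (auto simp: power2_eq_square algebra_simps)
  have "dirichlet ?v = dirichlet u + sum ?d (Pair z ` ?N \<union> (\<lambda>y. (y, z)) ` ?N)"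
    unfolding dirichlet_def
  proof (rule infsum_finite_change)
    show "(?v (snd e) - ?v (fst e))\<^sup>2 = (u (snd e) - u (fst e))\<^sup>2"
      if "e \<in> {(x, y). adj x y} - (Pair z ` ?N \<union> (\<lambda>y. (y, z)) ` ?N)" for e
      using that by (auto simp: adj_commute)
  qed (use assms in \<open>auto simp: finite_adj adj_commute[of _ z] simp del: fun_upd_apply
          intro!: summable_dirichlet_finitely_supported finitely_supported_update\<close>)
  also have "sum ?d (Pair z ` ?N \<union> (\<lambda>y. (y, z)) ` ?N)
      = sum ?d (Pair z ` ?N) + sum ?d ((\<lambda>y. (y, z)) ` ?N)"
    by (rule sum.union_disjoint) (auto simp: finite_adj)
  also have "sum ?d (Pair z ` ?N) = (\<Sum>y\<in>?N. t\<^sup>2 - 2 * t * (u y - u z))"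
    by (subst sum.reindex) (auto simp: inj_on_def d o_def simp del: fun_upd_apply intro!: sum.cong)
  also have "sum ?d ((\<lambda>y. (y, z)) ` ?N) = (\<Sum>y\<in>?N. t\<^sup>2 - 2 * t * (u y - u z))"
    by (subst sum.reindex) (auto simp: inj_on_def d o_def simp del: fun_upd_apply intro!: sum.cong)
  finally show ?thesis
    by linarith
qed

lemma pow_sum_nonneg: "pow_sum s u \<ge> 0"
  by (simp add: pow_sum_def infsum_nonneg)

lemma dirichlet_nonneg: "dirichlet u \<ge> 0"
  by (auto simp: dirichlet_def intro: infsum_nonneg)

lemma sum_le_pow_sum:
  assumes "finitely_supported u" "finite F"
  shows "(\<Sum>x\<in>F. \<bar>u x\<bar> powr s) \<le> pow_sum s u"
  unfolding pow_sum_def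
  by (intro finite_sum_le_infsum summable_pow_finitely_supported) (use assms in auto)

text \<open>Split off \<open>\<bar>u x\<bar> powr (q - p)\<close> and bound it by the supremum. With
  \<open>M\<close> the p-norm this yields the embedding below; with \<open>M\<close> a small
  constant it excludes vanishing of minimising sequences.\<close>

lemma pow_sum_le:
  assumes u: "finitely_supported u" and M: "\<And>x. \<bar>u x\<bar> \<le> M" and "p \<le> q" 
  shows "pow_sum q u \<le> M powr (q - p) * pow_sum p u"
proof -
  have "\<bar>u x\<bar> powr q \<le> M powr (q - p) * \<bar>u x\<bar> powr p" for x
  proof -
    have "\<bar>u x\<bar> powr q = \<bar>u x\<bar> powr (q - p) * \<bar>u x\<bar> powr p"
      by (simp flip: powr_add)
    also have "\<dots> \<le> M powr (q - p) * \<bar>u x\<bar> powr p"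
      by (intro mult_right_mono powr_mono2) (use assms in auto)
    finally show ?thesis .
  qed
  then show ?thesis
    unfolding pow_sum_def infsum_cmult_right'[symmetric]
    by (intro infsum_mono summable_on_cmult_right summable_pow_finitely_supported u) auto
qed

lemma abs_le_pow_sum:
  assumes "finitely_supported u" "0 < s"
  shows "\<bar>u x\<bar> \<le> pow_sum s u powr (1 / s)"
proof -
  have "\<bar>u x\<bar> powr s \<le> pow_sum s u"
    using sum_le_pow_sum[OF assms(1), of "{x}" s] by simp
  then have "(\<bar>u x\<bar> powr s) powr (1 / s) \<le> pow_sum s u powr (1 / s)"
    using assms by (intro powr_mono2) auto
  then show ?thesis
    using assms by (simp add: powr_powr)
qed

text \<open>The embedding of the p-space into the q-space with constant 1, obtained by bounding the
  supremum by the p-norm. Both sides are raised to the power \<open>p\<close> for comparison with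
  the middle term of the energy.\<close>

lemma pow_sum_powr_mono:
  assumes "finitely_supported u" "0 < p" "p \<le> q"
  shows "(pow_sum q u powr (1 / q)) powr p \<le> pow_sum p u"
proof -
  have "pow_sum q u \<le> (pow_sum p u powr (1 / p)) powr (q - p) * pow_sum p u"
    using assms by (intro pow_sum_le abs_le_pow_sum) auto
  also have "\<dots> = pow_sum p u powr ((q - p) / p) * pow_sum p u powr 1"
    using pow_sum_nonneg[of p u] by (simp add: powr_powr)
  also have "\<dots> = pow_sum p u powr (q / p)"
    unfolding powr_add[symmetric] using assms by (simp add: diff_divide_distrib)
  finally have "pow_sum q u powr (p / q) \<le> (pow_sum p u powr (q / p)) powr (p / q)"
    using assms pow_sum_nonneg[of q u] by (intro powr_mono2) auto
  then show ?thesis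
    using assms pow_sum_nonneg[of p u] by (simp add: powr_powr)
qed

text \<open>The reverse triangle inequality on each edge; the power sums depend only on absolute
  values.\<close>

lemma energy_abs_le:
  assumes "finitely_supported u"
  shows "energy p q a k (\<lambda>x. \<bar>u x\<bar>) \<le> energy p q a k u"
proof -
  have "finitely_supported (\<lambda>x. \<bar>u x\<bar>)"
    using assms by (simp add: finitely_supported_def)
  then have "dirichlet (\<lambda>x. \<bar>u x\<bar>) \<le> dirichlet u"
    unfolding dirichlet_def
    using assms by (intro infsum_mono summable_dirichlet_finitely_supported)
      (auto simp flip: abs_le_square_iff)
  then show ?thesis
    by (simp add: energy_def pow_sum_def)
qed

lemma energy_translate: "energy p q a k (\<lambda>x. u (x + h)) = energy p q a k u"
proof -
  have "bij_betw (\<lambda>e. (fst e + h, snd e + h)) {(x, y). adj x y} {(x, y). adj x y}"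
    by (rule bij_betwI[where g = "\<lambda>e. (fst e - h, snd e - h)"])
       (auto simp: adj_def)
  from infsum_reindex_bij_betw[OF this, of "\<lambda>e. (u (snd e) - u (fst e))\<^sup>2"]
  have "dirichlet (\<lambda>x. u (x + h)) = dirichlet u"
    by (simp add: dirichlet_def)
  moreover have "bij_betw (\<lambda>x. x + h) UNIV UNIV"
    by (rule bij_betwI[where g = "\<lambda>x. x - h"]) auto
  from infsum_reindex_bij_betw[OF this, of "\<lambda>x. \<bar>u x\<bar> powr s" for s]
  have "pow_sum s (\<lambda>x. u (x + h)) = pow_sum s u" for s
    by (simp add: pow_sum_def)
  ultimately show ?thesis
    by (simp add: energy_def)
qed

text \<open>The q-norm is not a sum over vertices, so \<open>pow_sum q u\<close> stays as the one
  global quantity; everything else involves \<open>z\<close> and its neighbours only.\<close>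

lemma energy_update:
  assumes "finitely_supported u"
  shows "energy p q a k (u(z := u z + t)) - energy p q a k u =
    1 / 2 * (\<Sum>y | adj z y. t\<^sup>2 - 2 * t * (u y - u z))
    + a / p * (\<bar>u z + t\<bar> powr p - \<bar>u z\<bar> powr p)
    - k * ((pow_sum q u + \<bar>u z + t\<bar> powr q - \<bar>u z\<bar> powr q) powr (1 / q) - pow_sum q u powr (1 / q))"
  unfolding energy_def dirichlet_update[OF assms] pow_sum_update[OF assms]
  by (simp add: algebra_simps add_divide_distrib)

section \<open>Cut-offs in the range and membership in \<open>E_space\<close>\<close>

lemma infsum_truncation_less:
  fixes h :: "'a \<Rightarrow> real"
  assumes h: "h summable_on UNIV" and "\<epsilon> > 0"
  shows "\<exists>\<eta>>0. \<forall>w. (\<forall>x. 0 \<le> w x \<and> w x \<le> h x \<and> w x \<le> \<eta>) \<longrightarrow> infsum w UNIV < \<epsilon>"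
proof -
  obtain F where F: "finite F" "dist (sum h F) (infsum h UNIV) \<le> \<epsilon> / 2"
    using infsum_finite_approximation[OF h, of "\<epsilon> / 2"] \<open>\<epsilon> > 0\<close> by auto
  \<comment> \<open>Outside \<open>F\<close> the tail of \<open>h\<close> is at most \<epsilon>/2;
    this \<eta> keeps the part over \<open>F\<close> below \<epsilon>/2. Adding 1 makes that strict
    and covers empty \<open>F\<close>.\<close>
  define \<eta> where "\<eta> = \<epsilon> / (2 * (card F + 1))"
  have "infsum w UNIV < \<epsilon>"
    if w: "\<And>x. 0 \<le> w x" "\<And>x. w x \<le> h x" "\<And>x. w x \<le> \<eta>" for w
  proof -
    have sw: "w summable_on UNIV"
      by (rule summable_on_comparison_test[OF h]) (use w in auto)
    have sub: "f summable_on UNIV \<Longrightarrow> f summable_on (-F)" for f :: "'a \<Rightarrow> real"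
      using summable_on_subset_banach by blast
    have split: "infsum f UNIV = sum f F + infsum f (-F)" if "f summable_on UNIV" for f :: "'a \<Rightarrow> real"
      using infsum_Un_disjoint[of f F "-F"] sub[OF that] \<open>finite F\<close> by simp
    have "infsum w (-F) \<le> infsum h (-F)"
      by (intro infsum_mono sub h sw w)
    also have "\<dots> \<le> \<epsilon> / 2"
      using F(2) split[OF h] by (simp add: dist_real_def)
    finally have 1: "infsum w (-F) \<le> \<epsilon> / 2" .
    have "sum w F \<le> card F * \<eta>"
      by (rule sum_bounded_above) (use w in auto)
    also have "\<dots> < \<epsilon> / 2"
      using \<open>\<epsilon> > 0\<close> by (simp add: \<eta>_def field_simps)
    finally show ?thesis
      using 1 split[OF sw] by simp
  qed
  moreover have "\<eta> > 0"
    using \<open>\<epsilon> > 0\<close> by (simp add: \<eta>_def)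
  ultimately show ?thesis
    by blast
qed

text \<open>A form of dominated convergence, uniform in \<open>w\<close>: one \<eta> serves the
  differences of all late pairs of cut-offs, which is what the Cauchy property asks for.\<close>

lemma ell_norm_truncation_less:
  assumes h: "(\<lambda>x. h x powr s) summable_on UNIV" and "0 < s" "\<epsilon> > 0"
  shows "\<exists>\<eta>>0. \<forall>w. (\<forall>x. \<bar>w x\<bar> \<le> h x \<and> \<bar>w x\<bar> \<le> \<eta>) \<longrightarrow> ell_norm s w < \<epsilon>"
proof -
  have \<epsilon>s: "\<epsilon> powr s > 0"
    using \<open>\<epsilon> > 0\<close> by simp
  obtain \<eta> where \<eta>: "\<eta> > 0" "\<And>w. (\<forall>x. 0 \<le> w x \<and> w x \<le> h x powr s \<and> w x \<le> \<eta>) \<Longrightarrow> infsum w UNIV < \<epsilon> powr s"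
    using infsum_truncation_less[OF h \<epsilon>s] by blast
  have "ell_norm s w < \<epsilon>"
    if w: "\<And>x. \<bar>w x\<bar> \<le> h x" "\<And>x. \<bar>w x\<bar> \<le> \<eta> powr (1 / s)" for w
  proof -
    have "\<bar>w x\<bar> powr s \<le> (\<eta> powr (1 / s)) powr s" for x
      using w \<open>0 < s\<close> by (intro powr_mono2) auto
    moreover have "\<bar>w x\<bar> powr s \<le> h x powr s" for x
      using w \<open>0 < s\<close> by (intro powr_mono2) auto
    ultimately have "(\<Sum>\<^sub>\<infinity>x. \<bar>w x\<bar> powr s) < \<epsilon> powr s"
      using \<open>0 < s\<close> \<open>\<eta> > 0\<close> by (intro \<eta>(2)) (simp add: powr_powr)
    then have "ell_norm s w < (\<epsilon> powr s) powr (1 / s)"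
      unfolding ell_norm_def using \<open>0 < s\<close> by (intro powr_less_mono2) (auto intro: infsum_nonneg)
    then show ?thesis
      using assms by (simp add: powr_powr)
  qed
  moreover have "\<eta> powr (1 / s) > 0"
    using \<eta>(1) by simp
  ultimately show ?thesis
    by blast
qed

lemma grad_length_mono:
  assumes "\<And>y. \<bar>v y - v x\<bar> \<le> \<bar>u y - u x\<bar>"
  shows "grad_length v x \<le> grad_length u x"
  unfolding grad_length_def
  by (intro real_sqrt_le_mono mult_left_mono sum_mono) (use assms in \<open>auto simp: abs_le_square_iff\<close>)

lemma card_adj_le: "card {y :: int ^ 'n. adj x y} \<le> 3 ^ CARD('n)"
proof -
  have "y $ i \<in> {x $ i - 1..x $ i + 1}" if "adj x y" for y :: "int ^ 'n" and i
  proof -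
    have "\<bar>x $ i - y $ i\<bar> \<le> (\<Sum>i\<in>UNIV. \<bar>x $ i - y $ i\<bar>)"
      by (rule member_le_sum) auto
    then show ?thesis
      using that by (auto simp: adj_def)
  qed
  then have "($) ` {y :: int ^ 'n. adj x y} \<subseteq> (\<Pi>\<^sub>E i\<in>UNIV. {x $ i - 1..x $ i + 1})"
    by (auto simp: PiE_def Pi_def)
  then have "card (($) ` {y :: int ^ 'n. adj x y}) \<le> card (\<Pi>\<^sub>E i\<in>UNIV. {x $ i - 1..x $ i + 1})"
    by (intro card_mono finite_PiE) auto
  moreover have "inj_on ($) {y :: int ^ 'n. adj x y}"
    by (auto simp: inj_on_def vec_eq_iff)
  ultimately show ?thesis
    by (simp add: card_image card_PiE)
qed

lemma grad_length_le:
  fixes v :: "int ^ 'n \<Rightarrow> real"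
  assumes "\<And>y. \<bar>v y\<bar> \<le> \<eta>"
  shows "grad_length v x \<le> 2 ^ CARD('n) * (2 * \<eta>)"
proof -
  have "\<eta> \<ge> 0"
    using assms[of 0] by linarith
  \<comment> \<open>The bound is weakened from a power of 3 to a power of 4, whose square root is a
    power of 2.\<close>
  have "card {y. adj x y} \<le> (4 :: nat) ^ CARD('n)"
    by (rule order_trans[OF card_adj_le]) (simp add: power_mono)
  then have card: "real (card {y. adj x y}) \<le> 4 ^ CARD('n)"
    using of_nat_mono by fastforce
  have "(v y - v x)\<^sup>2 \<le> (2 * \<eta>)\<^sup>2" for y
    using assms[of x] assms[of y] by (intro abs_le_square_iff[THEN iffD1]) linarith
  then have "(\<Sum>y | adj x y. (v y - v x)\<^sup>2) \<le> card {y. adj x y} * (2 * \<eta>)\<^sup>2"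
    by (intro sum_bounded_above) auto
  also have "\<dots> \<le> 4 ^ CARD('n) * (2 * \<eta>)\<^sup>2"
    using card by (intro mult_right_mono) auto
  also have "\<dots> = (2 ^ CARD('n) * (2 * \<eta>))\<^sup>2"
    by (simp add: power_mult_distrib power2_eq_square flip: power_mult_distrib[of 2 2])
  finally have "1 / 2 * (\<Sum>y | adj x y. (v y - v x)\<^sup>2) \<le> (2 ^ CARD('n) * (2 * \<eta>))\<^sup>2"
    using sum_nonneg[of "{y. adj x y}" "\<lambda>y. (v y - v x)\<^sup>2"] by simp
  then show ?thesis
    unfolding grad_length_def using \<open>\<eta> \<ge> 0\<close> by (intro real_le_lsqrt) auto
qed

lemma max_diff_le_self:
  fixes s c d :: real
  assumes "0 \<le> s" "0 \<le> c" "0 \<le> d"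
  shows "\<bar>max (s - c) 0 - max (s - d) 0\<bar> \<le> s"
  using assms by (simp add: max_def abs_if)

lemma max_diff_le_shift:
  fixes s c d e :: real
  assumes "0 \<le> s" "0 \<le> c" "0 \<le> d" "c \<le> e" "d \<le> e"
  shows "\<bar>max (s - c) 0 - max (s - d) 0\<bar> \<le> e"
  using assms by (simp add: max_def abs_if)

text \<open>As a function of \<open>s\<close>, the difference of two cut-offs is constant except
  between \<open>c\<close> and \<open>d\<close>, where its slope is 1 or -1. So its gradient is
  dominated by that of \<open>u\<close> without a factor 2.\<close>

lemma max_diff_Lipschitz:
  fixes s t c d :: real
  shows "\<bar>(max (s - c) 0 - max (s - d) 0) - (max (t - c) 0 - max (t - d) 0)\<bar> \<le> \<bar>s - t\<bar>"
  unfolding max_def abs_if by (simp split: if_split)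

text \<open>Cutting \<open>u\<close> off in its range rather than in its domain controls the gradient: the map
  \<open>s \<mapsto> max (s - \<epsilon>) 0\<close> is Lipschitz, while the gradient of a cutoff on a ball is not controlled by
  the \<open>\<ell>\<^sup>p\<close> norm of \<open>u\<close> if \<open>p > 2\<close>.\<close>

lemma E_space_I:
  fixes u :: "int ^ 'n \<Rightarrow> real"
  assumes "0 < p" "0 < q" and nonneg: "\<And>x. 0 \<le> u x"
    and sp: "(\<lambda>x. u x powr p) summable_on UNIV"
    and sq: "(\<lambda>x. u x powr q) summable_on UNIV"
    and sg: "(\<lambda>x. grad_length u x powr 2) summable_on UNIV"
  shows "u \<in> E_space p q"
proof -
  define \<phi> where "\<phi> k x = max (u x - 1 / real (Suc k)) 0" for k :: nat and x
  have lim0: "(\<lambda>k. 1 / real (Suc k)) \<longlonglongrightarrow> 0"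
    using LIMSEQ_inverse_real_of_nat by (simp add: inverse_eq_divide)
  have fin: "finitely_supported (\<phi> k)" for k
  proof -
    define c where "c = (1 / real (Suc k)) powr p"
    have "c > 0"
      by (simp add: c_def)
    obtain C where C: "\<And>F. finite F \<Longrightarrow> (\<Sum>x\<in>F. u x powr p) \<le> C"
      using finite_sum_le_infsum[OF sp] by (metis UNIV_I powr_ge_zero subset_UNIV)
    \<comment> \<open>Chebyshev's argument: every point of the support contributes at least
      \<open>c\<close> to a sum bounded by \<open>C\<close>.\<close>
    have "finite {x. \<phi> k x \<noteq> 0} \<and> card {x. \<phi> k x \<noteq> 0} \<le> nat \<lceil>C / c\<rceil>"
    proof (rule finite_if_finite_subsets_card_bdd)
      fix F assume F: "F \<subseteq> {x. \<phi> k x \<noteq> 0}" "finite F"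
      have "card F * c \<le> (\<Sum>x\<in>F. u x powr p)"
      proof (rule sum_bounded_below)
        fix x assume "x \<in> F"
        then have "1 / real (Suc k) \<le> u x"
          using F by (auto simp: \<phi>_def max_def subset_iff split: if_splits)
        then show "c \<le> u x powr p"
          unfolding c_def using \<open>0 < p\<close> by (intro powr_mono2) auto
      qed
      with C[OF F(2)] have "card F * c \<le> C"
        by linarith
      then have "card F \<le> C / c"
        using \<open>c > 0\<close> by (simp add: field_simps)
      then show "card F \<le> nat \<lceil>C / c\<rceil>"
        by linarith
    qed
    then show ?thesis
      by (simp add: finitely_supported_def)
  qed
  have cauchy: "\<exists>M. \<forall>m\<ge>M. \<forall>n\<ge>M. E_norm p q (\<lambda>x. \<phi> m x - \<phi> n x) < \<epsilon>" if "\<epsilon> > 0" for \<epsilon>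
  proof -
    have \<epsilon>: "\<epsilon> / 3 > 0"
      using \<open>\<epsilon> > 0\<close> by simp
    obtain \<eta>1 where \<eta>1: "\<eta>1 > 0"
      "\<And>w. (\<forall>x. \<bar>w x\<bar> \<le> grad_length u x \<and> \<bar>w x\<bar> \<le> \<eta>1) \<Longrightarrow> ell_norm 2 w < \<epsilon> / 3"
      using ell_norm_truncation_less[OF sg zero_less_numeral \<epsilon>] by blast
    obtain \<eta>2 where \<eta>2: "\<eta>2 > 0"
      "\<And>w. (\<forall>x. \<bar>w x\<bar> \<le> u x \<and> \<bar>w x\<bar> \<le> \<eta>2) \<Longrightarrow> ell_norm p w < \<epsilon> / 3"
      using ell_norm_truncation_less[OF sp \<open>0 < p\<close> \<epsilon>] by blast
    obtain \<eta>3 where \<eta>3: "\<eta>3 > 0"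
      "\<And>w. (\<forall>x. \<bar>w x\<bar> \<le> u x \<and> \<bar>w x\<bar> \<le> \<eta>3) \<Longrightarrow> ell_norm q w < \<epsilon> / 3"
      using ell_norm_truncation_less[OF sq \<open>0 < q\<close> \<epsilon>] by blast
    \<comment> \<open>The three norms each impose a cut-off level; the first entry undoes the factor
      from \<open>grad_length_le\<close>.\<close>
    define \<eta> where "\<eta> = Min {\<eta>1 / (2 ^ CARD('n) * 2), \<eta>2, \<eta>3}"
    have \<eta>: "\<eta> > 0" "2 ^ CARD('n) * (2 * \<eta>) \<le> \<eta>1" "\<eta> \<le> \<eta>2" "\<eta> \<le> \<eta>3"
    proof -
      have "\<eta> \<le> \<eta>1 / (2 ^ CARD('n) * 2)"
        by (simp add: \<eta>_def)
      then show "2 ^ CARD('n) * (2 * \<eta>) \<le> \<eta>1"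
        by (simp add: field_simps)
    qed (use \<eta>1 \<eta>2 \<eta>3 in \<open>simp_all add: \<eta>_def\<close>)
    obtain M where M: "\<And>k. k \<ge> M \<Longrightarrow> 1 / real (Suc k) < \<eta>"
      using order_tendstoD(2)[OF lim0 \<eta>(1)] by (auto simp: eventually_sequentially)
    have "E_norm p q (\<lambda>x. \<phi> m x - \<phi> n x) < \<epsilon>" if "m \<ge> M" "n \<ge> M" for m n
    proof -
      let ?w = "\<lambda>x. \<phi> m x - \<phi> n x"
      have pos: "1 / real (Suc k) \<ge> 0" for k
        by simp
      have wu: "\<bar>?w x\<bar> \<le> u x" for x
        unfolding \<phi>_def by (rule max_diff_le_self[OF nonneg pos pos])
      have w\<eta>: "\<bar>?w x\<bar> \<le> \<eta>" for x
        unfolding \<phi>_def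
        by (rule max_diff_le_shift[OF nonneg pos pos less_imp_le[OF M] less_imp_le[OF M]]) (fact that)+
      have "\<bar>?w y - ?w x\<bar> \<le> \<bar>u y - u x\<bar>" for x y
        unfolding \<phi>_def by (rule max_diff_Lipschitz)
      then have "grad_length ?w x \<le> grad_length u x" for x
        by (rule grad_length_mono)
      moreover have "grad_length ?w x \<le> \<eta>1" for x
        using grad_length_le[of ?w \<eta>, OF w\<eta>] \<eta>(2) by (meson order_trans)
      moreover have "grad_length ?w x \<ge> 0" for x
        by (simp add: grad_length_def sum_nonneg)
      ultimately have "ell_norm 2 (grad_length ?w) < \<epsilon> / 3"
        by (intro \<eta>1(2) allI conjI) simp_all
      moreover have "ell_norm p ?w < \<epsilon> / 3"
        by (intro \<eta>2(2) allI conjI wu order_trans[OF w\<eta>] \<eta>)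
      moreover have "ell_norm q ?w < \<epsilon> / 3"
        by (intro \<eta>3(2) allI conjI wu order_trans[OF w\<eta>] \<eta>)
      ultimately show ?thesis
        by (simp add: E_norm_def)
    qed
    then show ?thesis
      by (intro exI[of _ M] allI impI)
  qed
  have "(\<lambda>k. \<phi> k x) \<longlonglongrightarrow> u x" for x
  proof -
    have "(\<lambda>k. max (u x - 1 / real (Suc k)) 0) \<longlonglongrightarrow> max (u x - 0) 0"
      by (intro tendsto_intros lim0)
    then show ?thesis
      using nonneg[of x] by (simp add: \<phi>_def)
  qed
  with fin cauchy show ?thesis
    unfolding E_space_def by (intro CollectI exI[of _ \<phi>] conjI allI impI)
qed

section \<open>Summability of pointwise limits and translated functions\<close>

lemma summable_on_pointwise_limit:
  fixes f :: "nat \<Rightarrow> 'a \<Rightarrow> real"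
  assumes lim: "\<And>x. (\<lambda>n. f n x) \<longlonglongrightarrow> g x" and nonneg: "\<And>n x. 0 \<le> f n x"
    and bound: "\<And>n F. finite F \<Longrightarrow> (\<Sum>x\<in>F. f n x) \<le> C"
  shows "g summable_on UNIV"
proof (rule nonneg_bdd_above_summable_on)
  show "0 \<le> g x" for x
    by (rule LIMSEQ_le_const[OF lim]) (use nonneg in auto)
  \<comment> \<open>As in Fatou's lemma, a uniform bound on finite partial sums survives the
    pointwise limit.\<close>
  have "(\<Sum>x\<in>F. g x) \<le> C" if "finite F" for F
    by (rule LIMSEQ_le_const2[OF tendsto_sum[OF lim]]) (use bound that in auto)
  then show "bdd_above (sum g ` {F. F \<subseteq> UNIV \<and> finite F})"
    by (intro bdd_aboveI2) auto
qed

text \<open>The left side is half the sum over the ordered edges that start in \<open>F\<close>, a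
  part of the sum \<open>dirichlet u\<close>.\<close>

lemma sum_grad_length_le_dirichlet:
  fixes u :: "int ^ 'n \<Rightarrow> real"
  assumes "finitely_supported u" "finite F"
  shows "(\<Sum>x\<in>F. grad_length u x powr 2) \<le> dirichlet u / 2"
proof -
  have "grad_length u x powr 2 = 1 / 2 * (\<Sum>y | adj x y. (u y - u x)\<^sup>2)" for x
    by (simp add: grad_length_def sum_nonneg)
  then have "(\<Sum>x\<in>F. grad_length u x powr 2) = (\<Sum>x\<in>F. \<Sum>y | adj x y. (u y - u x)\<^sup>2) / 2"
    by (simp add: sum_divide_distrib)
  also have "(\<Sum>x\<in>F. \<Sum>y | adj x y. (u y - u x)\<^sup>2)
      = (\<Sum>e\<in>Sigma F (\<lambda>x. {y. adj x y}). (u (snd e) - u (fst e))\<^sup>2)"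
    by (subst sum.Sigma) (use assms in \<open>auto simp: finite_adj case_prod_beta\<close>)
  also have "\<dots> \<le> dirichlet u"
    unfolding dirichlet_def
    by (intro finite_sum_le_infsum summable_dirichlet_finitely_supported)
       (use assms in \<open>auto simp: finite_adj\<close>)
  finally show ?thesis
    by simp
qed

lemma finitely_supported_abs_translate:
  assumes "finitely_supported u"
  shows "finitely_supported (\<lambda>x. \<bar>u (x + h)\<bar>)"
proof -
  have "{x. \<bar>u (x + h)\<bar> \<noteq> 0} \<subseteq> (\<lambda>x. x - h) ` {x. u x \<noteq> 0}"
  proof
    fix x assume "x \<in> {x. \<bar>u (x + h)\<bar> \<noteq> 0}"
    then show "x \<in> (\<lambda>x. x - h) ` {x. u x \<noteq> 0}"
      by (intro image_eqI[of _ _ "x + h"]) auto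
  qed
  then show ?thesis
    using assms unfolding finitely_supported_def by (meson finite_imageI finite_subset)
qed

section \<open>Consequences of minimality under changes of one value\<close>

lemma one_point_Euler_Lagrange:
  fixes u :: "int ^ 'n \<Rightarrow> real"
  assumes "0 < p" "0 < q" "u z > 0" "G > 0"
    and min: "\<And>t. 0 \<le> 1 / 2 * (\<Sum>y | adj z y. t\<^sup>2 - 2 * t * (u y - u z))
      + a / p * (\<bar>u z + t\<bar> powr p - \<bar>u z\<bar> powr p)
      - k * ((G + \<bar>u z + t\<bar> powr q - \<bar>u z\<bar> powr q) powr (1 / q) - G powr (1 / q))"
  shows "- laplacian u z + a * u z powr (p - 1) - k * G powr (1 / q - 1) * u z powr (q - 1) = 0"
proof (rule DERIV_local_min)
  \<comment> \<open>This is the expression in \<open>min\<close> without absolute values. The two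
    agree for \<bar>t\<bar> < \<open>u z\<close>, so 0 is a local minimum of a differentiable
    function.\<close>
  let ?D = "\<lambda>t. 1 / 2 * (\<Sum>y | adj z y. t\<^sup>2 - 2 * t * (u y - u z))
      + a / p * ((u z + t) powr p - u z powr p)
      - k * ((G + (u z + t) powr q - u z powr q) powr (1 / q) - G powr (1 / q))"
  have d_sum: "((\<lambda>t. \<Sum>y | adj z y. t\<^sup>2 - 2 * t * (u y - u z)) has_real_derivative
      (\<Sum>y | adj z y. - 2 * (u y - u z))) (at 0)"
    by (rule DERIV_sum) (auto intro!: derivative_eq_intros)
  have d_p: "((\<lambda>t. (u z + t) powr p - u z powr p) has_real_derivative p * u z powr (p - 1)) (at 0)"
    by (auto intro!: derivative_eq_intros simp: \<open>u z > 0\<close>)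
  have "((\<lambda>t. G + (u z + t) powr q - u z powr q) has_real_derivative q * u z powr (q - 1)) (at 0)"
    by (auto intro!: derivative_eq_intros simp: \<open>u z > 0\<close>)
  from DERIV_chain2[OF _ this, of "\<lambda>s. s powr (1 / q)" "1 / q * G powr (1 / q - 1)"]
  have "((\<lambda>t. (G + (u z + t) powr q - u z powr q) powr (1 / q)) has_real_derivative
      1 / q * G powr (1 / q - 1) * (q * u z powr (q - 1))) (at 0)"
    using \<open>G > 0\<close> has_real_derivative_powr[of G "1 / q"] by simp
  from DERIV_diff[OF this DERIV_const]
  have d_q: "((\<lambda>t. (G + (u z + t) powr q - u z powr q) powr (1 / q) - G powr (1 / q))
      has_real_derivative 1 / q * G powr (1 / q - 1) * (q * u z powr (q - 1))) (at 0)"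
    by simp
  have "(?D has_real_derivative 1 / 2 * (\<Sum>y | adj z y. - 2 * (u y - u z))
      + a / p * (p * u z powr (p - 1)) - k * (1 / q * G powr (1 / q - 1) * (q * u z powr (q - 1)))) (at 0)"
    by (intro DERIV_diff DERIV_add DERIV_cmult d_sum d_p d_q)
  moreover have "1 / 2 * (\<Sum>y | adj z y. - 2 * (u y - u z)) = - laplacian u z"
    by (simp add: laplacian_def sum_distrib_left sum_negf[symmetric] diff_divide_distrib)
  ultimately show "(?D has_real_derivative
      - laplacian u z + a * u z powr (p - 1) - k * G powr (1 / q - 1) * u z powr (q - 1)) (at 0)"
    using assms(1,2) by (simp add: mult.assoc)
  show "\<forall>t. \<bar>0 - t\<bar> < u z \<longrightarrow> ?D 0 \<le> ?D t"
  proof (intro allI impI)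
    fix t assume "\<bar>0 - t\<bar> < u z"
    then have "\<bar>u z + t\<bar> = u z + t" "\<bar>u z\<bar> = u z"
      by auto
    then show "?D 0 \<le> ?D t"
      using min[of t] \<open>u z > 0\<close> by simp
  qed
qed (use assms in simp)

text \<open>The strong maximum principle. Raising a zero value by \<open>t\<close> does not lower
  the q-norm, so that term may be dropped. The p-term is of order \<open>t\<^sup>2\<close> because
  \<open>p\<close> is at least 2, while the gradient term gains \<open>t\<close> times the sum of
  the neighbouring values; dividing by \<open>t\<close> forces this sum to be 0.\<close>

lemma neighbours_eq_0:
  fixes u :: "int ^ 'n \<Rightarrow> real"
  assumes "2 \<le> p" "0 < q" "0 \<le> a" "0 \<le> k" "0 \<le> G" and nonneg: "\<And>y. 0 \<le> u y" and "u z = 0" "adj z y"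
    and min: "\<And>t. 0 \<le> 1 / 2 * (\<Sum>y | adj z y. t\<^sup>2 - 2 * t * (u y - u z))
      + a / p * (\<bar>u z + t\<bar> powr p - \<bar>u z\<bar> powr p)
      - k * ((G + \<bar>u z + t\<bar> powr q - \<bar>u z\<bar> powr q) powr (1 / q) - G powr (1 / q))"
  shows "u y = 0"
proof -
  define c where "c = card {y. adj z y} / 2 + a / p"
  have *: "(\<Sum>y | adj z y. u y) \<le> c * t" if "0 < t" "t \<le> 1" for t
  proof -
    have "k * ((G + \<bar>u z + t\<bar> powr q - \<bar>u z\<bar> powr q) powr (1 / q) - G powr (1 / q)) \<ge> 0"
      using assms(2,4,5,7) by (intro mult_nonneg_nonneg) (auto intro!: powr_mono2)
    with min[of t] have "0 \<le> 1 / 2 * (\<Sum>y | adj z y. t\<^sup>2 - 2 * t * u y) + a / p * t powr p"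
      using \<open>u z = 0\<close> that by simp
    also have "(\<Sum>y | adj z y. t\<^sup>2 - 2 * t * u y)
        = card {y. adj z y} * t\<^sup>2 - 2 * t * (\<Sum>y | adj z y. u y)"
      by (simp add: sum_subtractf sum_distrib_left)
    also have "t powr p \<le> t powr 2"
      using that \<open>2 \<le> p\<close> by (intro powr_mono') auto
    then have "a / p * t powr p \<le> a / p * t\<^sup>2"
      using that assms by (intro mult_left_mono) auto
    finally have "t * (\<Sum>y | adj z y. u y) \<le> t * (c * t)"
      by (simp add: c_def algebra_simps power2_eq_square)
    then show ?thesis
      using that by simp
  qed
  have "((\<lambda>t. c * t) \<longlongrightarrow> c * 0) (at_right 0)"
    by (intro tendsto_intros)
  moreover have "\<forall>\<^sub>F t in at_right 0. (\<Sum>y | adj z y. u y) \<le> c * t"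
    using * unfolding eventually_at_right_field by (intro exI[of _ 1]) auto
  ultimately have "(\<Sum>y | adj z y. u y) \<le> 0"
    using tendsto_lowerbound[of "\<lambda>t. c * t" "c * 0" "at_right 0"] by simp
  then have "(\<Sum>y | adj z y. u y) = 0"
    by (intro antisym sum_nonneg) (use nonneg in auto)
  then show ?thesis
    using sum_nonneg_eq_0_iff[of "{y. adj z y}" u] nonneg finite_adj \<open>adj z y\<close> by auto
qed

section \<open>Minimisation for fixed parameters\<close>

locale lattice_parameters =
  fixes p q a R :: real
  assumes p: "2 \<le> p" and pq: "p < q" and a: "a > 0" and R: "R > 0"
begin

text \<open>With this coefficient, \<open>energy p q a k u \<le> 0\<close> forces \<open>\<parallel>u\<parallel>\<^sub>q \<le> R\<close>.\<close>

definition k :: real where "k = a / p * R powr (p - 1)"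

lemma k_pos: "k > 0"
  using p a R by (simp add: k_def)

text \<open>If the q-norm exceeded \<open>R\<close>, the embedding would make the p-term larger than
  the subtracted term and the energy positive. The other bounds follow by dropping nonnegative
  terms.\<close>

lemma energy_nonpos_bounds:
  fixes u :: "int ^ 'n \<Rightarrow> real"
  assumes u: "finitely_supported u" and le: "energy p q a k u \<le> 0"
  shows "pow_sum q u powr (1 / q) \<le> R"
    and "pow_sum p u \<le> p * k * R / a"
    and "dirichlet u \<le> 4 * k * R"
    and "- energy p q a k u \<le> k * pow_sum q u powr (1 / q)"
proof -
  let ?g = "pow_sum q u powr (1 / q)"
  have D: "dirichlet u \<ge> 0"
    by (rule dirichlet_nonneg)
  have P: "a / p * pow_sum p u \<ge> 0"
    using pow_sum_nonneg[of p u] p a by simp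
  have g: "?g \<ge> 0"
    by simp
  show gR: "?g \<le> R"
  proof (rule ccontr)
    assume "\<not> ?g \<le> R"
    then have "R powr (p - 1) < ?g powr (p - 1)"
      using p R by (intro powr_less_mono2) auto
    moreover have "?g > 0"
      using R \<open>\<not> ?g \<le> R\<close> by linarith
    ultimately have "R powr (p - 1) * ?g < ?g powr (p - 1) * ?g"
      by (rule mult_strict_right_mono)
    also have "\<dots> = ?g powr (p - 1) * ?g powr 1"
      by simp
    also have "\<dots> = ?g powr p"
      unfolding powr_add[symmetric] by simp
    also have "\<dots> \<le> pow_sum p u"
      using pow_sum_powr_mono[OF u, of p q] p pq by simp
    finally have "a / p * (R powr (p - 1) * ?g) < a / p * pow_sum p u"
      using p a by (intro mult_strict_left_mono) auto
    then show False
      using le D by (simp add: energy_def k_def algebra_simps)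
  qed
  then have kg: "k * ?g \<le> k * R"
    using k_pos by simp
  then show "pow_sum p u \<le> p * k * R / a"
  proof -
    have "a / p * pow_sum p u \<le> k * R"
      using le D kg by (simp add: energy_def)
    then show ?thesis
      using p a by (simp add: field_simps)
  qed
  show "dirichlet u \<le> 4 * k * R"
    using le P kg by (simp add: energy_def)
  show "- energy p q a k u \<le> k * ?g"
    using D P by (simp add: energy_def)
qed

text \<open>For a small spike of height \<open>t\<close> at the origin, the linear gain
  \<open>k * t\<close> beats the cost \<open>c * t\<^sup>2\<close>.\<close>

lemma exists_negative_energy:
  obtains u :: "int ^ 'n \<Rightarrow> real" where "finitely_supported u" "energy p q a k u < 0"
proof -
  define z :: "int ^ 'n \<Rightarrow> real" where "z = (\<lambda>_. 0)"
  have z: "finitely_supported z" "energy p q a k z = 0" "pow_sum q z = 0"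
    by (simp_all add: finitely_supported_def energy_def dirichlet_def pow_sum_def z_def)
  define c where "c = card {y :: int ^ 'n. adj 0 y} / 2 + a / p"
  have "c > 0"
    using p a by (auto simp: c_def intro: add_nonneg_pos)
  \<comment> \<open>The bound 1 gives \<open>t powr p \<le> t\<^sup>2\<close>; the other entry gives
    \<open>t * c \<le> k / 2\<close>.\<close>
  define t where "t = min 1 (k / (2 * c))"
  have t: "0 < t" "t \<le> 1" "t * c < k"
    using \<open>c > 0\<close> k_pos by (auto simp: t_def min_def field_simps)
  have "t powr p \<le> t powr 2"
    using t p by (intro powr_mono') auto
  then have *: "a / p * t powr p \<le> a / p * t\<^sup>2"
    using p a t by (intro mult_left_mono) auto
  have "energy p q a k (z(0 := t)) = card {y :: int ^ 'n. adj 0 y} / 2 * t\<^sup>2 + a / p * t powr p - k * t"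
    using energy_update[OF z(1), of p q a k 0 t] z(2,3) t(1) p pq
    by (simp add: z_def powr_powr)
  also have "\<dots> \<le> t * (t * c - k)"
    using * by (simp add: c_def algebra_simps power2_eq_square)
  also have "\<dots> < 0"
    using t by (simp add: mult_pos_neg)
  finally show ?thesis
    using that finitely_supported_update[OF z(1)] by blast
qed

text \<open>Almost-minimality is stated against every competitor, so the infimum itself does not
  appear. The constants \<delta> and \<open>c\<close> keep the limits of the values at 0 and of the
  q-power sums positive.\<close>

lemma minimizing_sequence:
  obtains u :: "nat \<Rightarrow> int ^ 'n \<Rightarrow> real" and \<epsilon> \<delta> c
  where "\<And>n. finitely_supported (u n)" "\<And>n x. 0 \<le> u n x" "\<And>n. energy p q a k (u n) \<le> 0"
    "\<And>n (v :: int ^ 'n \<Rightarrow> real). finitely_supported v \<Longrightarrow> energy p q a k (u n) - \<epsilon> n \<le> energy p q a k v"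
    "\<epsilon> \<longlonglongrightarrow> 0" "\<delta> > 0" "\<And>n. \<delta> \<le> u n 0" "c > 0" "\<And>n. c \<le> pow_sum q (u n)"
proof -
  define E where "E = (energy p q a k :: (int ^ 'n \<Rightarrow> real) \<Rightarrow> real)"
  define m where "m = Inf (E ` Collect finitely_supported)"
  have "- (k * R) \<le> E u" if "finitely_supported u" for u
  proof (cases "E u \<le> 0")
    case True
    then have "k * pow_sum q u powr (1 / q) \<le> k * R"
      using energy_nonpos_bounds(1)[OF that] k_pos by (simp add: E_def)
    then show ?thesis
      using energy_nonpos_bounds(4)[OF that] True by (simp add: E_def)
  next
    case False
    have "k * R > 0"
      using k_pos R by simp
    then show ?thesis
      using False by linarith
  qed
  then have bdd: "bdd_below (E ` Collect finitely_supported)"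
    by (intro bdd_belowI2) auto
  then have m: "m \<le> E u" if "finitely_supported u" for u
    unfolding m_def using that by (intro cInf_lower) auto
  obtain u0 :: "int ^ 'n \<Rightarrow> real" where u0: "finitely_supported u0" "E u0 < 0"
    using exists_negative_energy unfolding E_def by blast
  have "m < 0"
    using m[OF u0(1)] u0(2) by linarith
  \<comment> \<open>Errors of at most \<open>- m / 2\<close> keep all energies below the negative
    number \<open>m / 2\<close>.\<close>
  define \<epsilon> where "\<epsilon> n = - m / 2 * (1 / real (Suc n))" for n
  have \<epsilon>: "0 < \<epsilon> n" "\<epsilon> n \<le> - m / 2" for n
  proof -
    show "0 < \<epsilon> n"
      unfolding \<epsilon>_def by (rule mult_pos_pos) (use \<open>m < 0\<close> in auto)
    show "\<epsilon> n \<le> - m / 2"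
      unfolding \<epsilon>_def by (rule mult_left_le) (use \<open>m < 0\<close> in auto)
  qed
  have "(\<lambda>n. - m / 2 * (1 / real (Suc n))) \<longlonglongrightarrow> - m / 2 * 0"
    using LIMSEQ_inverse_real_of_nat by (intro tendsto_intros) (simp add: inverse_eq_divide)
  then have \<epsilon>0: "\<epsilon> \<longlonglongrightarrow> 0"
    by (simp add: \<epsilon>_def[abs_def])
  \<comment> \<open>An energy of at most \<open>m / 2\<close> and the last of
    \<open>energy_nonpos_bounds\<close> force the q-norm to be at least
    \<open>- m / (2 * k)\<close>.\<close>
  define c where "c = (- m / 2 / k) powr q"
  have "c > 0"
    using \<open>m < 0\<close> k_pos by (simp add: c_def)
  define C where "C = p * k * R / a"
  have "C > 0"
    using p k_pos R a by (simp add: C_def)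
  \<comment> \<open>The solution of \<open>\<delta> powr (q - p) * C = c / 2\<close>, where
    \<open>C\<close> bounds the p-power sums.\<close>
  define \<delta> where "\<delta> = (c / (2 * C)) powr (1 / (q - p))"
  have "\<delta> > 0"
    using \<open>c > 0\<close> \<open>C > 0\<close> by (simp add: \<delta>_def)
  have large: "c \<le> pow_sum q u" if "finitely_supported u" "E u \<le> m / 2" for u
  proof -
    have "- m / 2 / k \<le> pow_sum q u powr (1 / q)"
      using energy_nonpos_bounds(4)[OF that(1)] that(2) \<open>m < 0\<close> k_pos by (simp add: E_def field_simps)
    then have "c \<le> (pow_sum q u powr (1 / q)) powr q"
      unfolding c_def using \<open>m < 0\<close> k_pos p pq by (intro powr_mono2) (auto simp: field_simps)
    then show ?thesis
      using pow_sum_nonneg[of q u] p pq by (simp add: powr_powr)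
  qed
  \<comment> \<open>No vanishing: \<open>\<parallel>u\<parallel>\<^sub>q\<^sup>q \<le> (sup \<bar>u\<bar>)\<^bsup>q - p\<^esup> \<parallel>u\<parallel>\<^sub>p\<^sup>p\<close> bounds the supremum from below.\<close>
  have peak: "\<exists>x. \<delta> \<le> \<bar>u x\<bar>" if u: "finitely_supported u" "E u \<le> m / 2" for u
  proof (rule ccontr)
    assume "\<not> ?thesis"
    then have "pow_sum q u \<le> \<delta> powr (q - p) * pow_sum p u"
      using pq by (intro pow_sum_le u) (auto simp: not_le less_imp_le)
    also have "\<dots> \<le> \<delta> powr (q - p) * C"
      unfolding C_def using energy_nonpos_bounds(2)[OF u(1)] u(2) \<open>m < 0\<close>
      by (intro mult_left_mono) (auto simp: E_def)
    also have "\<dots> = c / 2"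
      using \<open>c > 0\<close> \<open>C > 0\<close> pq by (simp add: \<delta>_def powr_powr)
    finally show False
      using large[OF u] \<open>c > 0\<close> by simp
  qed
  have "\<exists>u. finitely_supported u \<and> (\<forall>x. 0 \<le> u x) \<and> E u \<le> m + \<epsilon> n \<and> \<delta> \<le> u 0" for n
  proof -
    have "m < m + \<epsilon> n"
      using \<epsilon>[of n] by simp
    then obtain v where v: "finitely_supported v" "E v < m + \<epsilon> n"
      using cInf_lessD[of "E ` Collect finitely_supported" "m + \<epsilon> n"] u0(1)
      unfolding m_def by blast
    then obtain h where h: "\<delta> \<le> \<bar>v h\<bar>"
      using peak[of v] \<epsilon>(2)[of n] by auto
    \<comment> \<open>Translation by the peak \<open>h\<close> keeps the energy and taking absolute
      values does not raise it.\<close>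
    have "E (\<lambda>x. \<bar>v (x + h)\<bar>) \<le> E v"
      unfolding E_def energy_translate[of p q a k "\<lambda>x. \<bar>v x\<bar>" h]
      by (rule energy_abs_le[OF v(1)])
    then show ?thesis
      using v h finitely_supported_abs_translate[OF v(1), of h]
      by (intro exI[of _ "\<lambda>x. \<bar>v (x + h)\<bar>"]) auto
  qed
  then obtain u where u: "\<And>n. finitely_supported (u n)" "\<And>n x. 0 \<le> u n x"
      "\<And>n. E (u n) \<le> m + \<epsilon> n" "\<And>n. \<delta> \<le> u n 0"
    by metis
  have half: "E (u n) \<le> m / 2" for n
    using u(3)[of n] \<epsilon>(2)[of n] by linarith
  show ?thesis
  proof (rule that[of u \<epsilon> \<delta> c])
    show "energy p q a k (u n) \<le> 0" for n
      using half[of n] \<open>m < 0\<close> unfolding E_def by linarith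
    show "energy p q a k (u n) - \<epsilon> n \<le> energy p q a k v" if "finitely_supported v" for n and v :: "int ^ 'n \<Rightarrow> real"
      using m[OF that] u(3)[of n] unfolding E_def by linarith
    show "c \<le> pow_sum q (u n)" for n
      using large[OF u(1) half] .
  qed (use u \<epsilon>0 \<open>\<delta> > 0\<close> \<open>c > 0\<close> in auto)
qed

lemma exists_positive_solution:
  obtains u :: "int ^ 'n \<Rightarrow> real" and b
  where "u \<in> E_space p q" "\<And>x. u x > 0" "is_solution p q a b u" "b \<ge> a / p * R powr (p - q)"
proof -
  obtain u :: "nat \<Rightarrow> int ^ 'n \<Rightarrow> real" and \<epsilon> \<delta> c where
    fs: "\<And>n. finitely_supported (u n)" and nonneg: "\<And>n x. 0 \<le> u n x"
    and neg: "\<And>n. energy p q a k (u n) \<le> 0"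
    and min: "\<And>n (v :: int ^ 'n \<Rightarrow> real). finitely_supported v \<Longrightarrow> energy p q a k (u n) - \<epsilon> n \<le> energy p q a k v"
    and \<epsilon>: "\<epsilon> \<longlonglongrightarrow> 0" and \<delta>: "\<delta> > 0" "\<And>n. \<delta> \<le> u n 0"
    and c: "c > 0" "\<And>n. c \<le> pow_sum q (u n)"
    using minimizing_sequence by blast
  note bounds = energy_nonpos_bounds[OF fs neg]
  have G_le: "pow_sum q (u n) \<le> R powr q" for n
  proof -
    have "(pow_sum q (u n) powr (1 / q)) powr q \<le> R powr q"
      using bounds(1)[of n] p pq by (intro powr_mono2) auto
    then show ?thesis
      using pow_sum_nonneg[of q "u n"] p pq by (simp add: powr_powr)
  qed
  \<comment> \<open>Along \<open>r\<close> the q-power sums converge; along the further subsequence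
    \<open>s\<close> so do the values at all of the countably many vertices. The limit
    \<open>G\<close> is not identified with \<open>pow_sum q U\<close>.\<close>
  then have "bounded (range (\<lambda>n. pow_sum q (u n)))"
    by (intro boundedI[of _ "R powr q"]) (auto simp: pow_sum_nonneg)
  from bounded_imp_convergent_subsequence[OF this]
  obtain G r where r: "strict_mono r" "(\<lambda>n. pow_sum q (u (r n))) \<longlonglongrightarrow> G"
    by (auto simp: o_def)
  have "norm (u (r n) x) \<le> R" for n x
    using abs_le_pow_sum[OF fs, of q "r n" x] bounds(1)[of "r n"] p pq by simp
  then obtain s where s: "strict_mono s"
      "\<And>x. x \<in> UNIV \<Longrightarrow> \<exists>l. (\<lambda>n. u (r (s n)) x) \<longlonglongrightarrow> l"
    using function_convergent_subsequence[of UNIV "\<lambda>n. u (r n)" R, OF countableI_type] by blast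
  define w where "w n = u (r (s n))" for n
  obtain U where U: "\<And>x. (\<lambda>n. w n x) \<longlonglongrightarrow> U x"
    using s(2)[OF UNIV_I] unfolding w_def by metis
  have G: "(\<lambda>n. pow_sum q (w n)) \<longlonglongrightarrow> G"
    using LIMSEQ_subseq_LIMSEQ[OF r(2) s(1)] by (simp add: w_def o_def)
  have \<epsilon>': "(\<lambda>n. \<epsilon> (r (s n))) \<longlonglongrightarrow> 0"
    using LIMSEQ_subseq_LIMSEQ[OF \<epsilon> strict_mono_o[OF r(1) s(1)]] by (simp add: o_def)
  have "c \<le> G"
    by (rule LIMSEQ_le_const[OF G]) (use c in \<open>auto simp: w_def\<close>)
  with c have "G > 0"
    by simp
  have "G \<le> R powr q"
    by (rule LIMSEQ_le_const2[OF G]) (use G_le in \<open>auto simp: w_def\<close>)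
  have U_nonneg: "0 \<le> U x" for x
    by (rule LIMSEQ_le_const[OF U]) (use nonneg in \<open>auto simp: w_def\<close>)
  have "\<delta> \<le> U 0"
    by (rule LIMSEQ_le_const[OF U]) (use \<delta> in \<open>auto simp: w_def\<close>)
  have pos: "0 < p" "0 < q"
    using p pq by auto
  \<comment> \<open>Each one-point change of \<open>w n\<close> has energy gain at least
    \<open>- \<epsilon> (r (s n))\<close>, and both sides of this inequality converge.\<close>
  have test: "0 \<le> 1 / 2 * (\<Sum>y | adj z y. t\<^sup>2 - 2 * t * (U y - U z))
      + a / p * (\<bar>U z + t\<bar> powr p - \<bar>U z\<bar> powr p)
      - k * ((G + \<bar>U z + t\<bar> powr q - \<bar>U z\<bar> powr q) powr (1 / q) - G powr (1 / q))" for z t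
  proof (rule tendsto_le[OF sequentially_bot])
    show "(\<lambda>n. - \<epsilon> (r (s n))) \<longlonglongrightarrow> 0"
      using tendsto_minus[OF \<epsilon>'] by simp
    \<comment> \<open>The base is the power sum of the updated function. Its sign matters for the
      limit of the q-th root in case the limit base is 0.\<close>
    have "pow_sum q (w n) + \<bar>w n z + t\<bar> powr q - \<bar>w n z\<bar> powr q \<ge> 0" for n
      using pow_sum_nonneg[of q "(w n)(z := w n z + t)"] fs by (simp add: pow_sum_update w_def)
    then show "(\<lambda>n. 1 / 2 * (\<Sum>y | adj z y. t\<^sup>2 - 2 * t * (w n y - w n z))
      + a / p * (\<bar>w n z + t\<bar> powr p - \<bar>w n z\<bar> powr p)
      - k * ((pow_sum q (w n) + \<bar>w n z + t\<bar> powr q - \<bar>w n z\<bar> powr q) powr (1 / q)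
        - pow_sum q (w n) powr (1 / q))) \<longlonglongrightarrow>
      1 / 2 * (\<Sum>y | adj z y. t\<^sup>2 - 2 * t * (U y - U z))
      + a / p * (\<bar>U z + t\<bar> powr p - \<bar>U z\<bar> powr p)
      - k * ((G + \<bar>U z + t\<bar> powr q - \<bar>U z\<bar> powr q) powr (1 / q) - G powr (1 / q))"
      using pos pow_sum_nonneg by (intro tendsto_intros tendsto_powr' U G) (auto intro!: always_eventually)
    show "\<forall>\<^sub>F n in sequentially. - \<epsilon> (r (s n)) \<le> 1 / 2 * (\<Sum>y | adj z y. t\<^sup>2 - 2 * t * (w n y - w n z))
      + a / p * (\<bar>w n z + t\<bar> powr p - \<bar>w n z\<bar> powr p)
      - k * ((pow_sum q (w n) + \<bar>w n z + t\<bar> powr q - \<bar>w n z\<bar> powr q) powr (1 / q)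
        - pow_sum q (w n) powr (1 / q))"
    proof (rule always_eventually, rule allI)
      fix n
      show "- \<epsilon> (r (s n)) \<le> 1 / 2 * (\<Sum>y | adj z y. t\<^sup>2 - 2 * t * (w n y - w n z))
        + a / p * (\<bar>w n z + t\<bar> powr p - \<bar>w n z\<bar> powr p)
        - k * ((pow_sum q (w n) + \<bar>w n z + t\<bar> powr q - \<bar>w n z\<bar> powr q) powr (1 / q)
          - pow_sum q (w n) powr (1 / q))"
        using min[of "(w n)(z := w n z + t)" "r (s n)"] fs[of "r (s n)"]
          energy_update[of "w n" p q a k z t]
        by (simp add: w_def finitely_supported_update del: fun_upd_apply)
    qed
  qed
  have U_pos: "0 < U x" for x
  proof (rule adj_connected[where P = "\<lambda>x. 0 < U x"])
    fix x y :: "int ^ 'n" assume "0 < U x" "adj x y"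
    \<comment> \<open>A zero at \<open>y\<close> would force its neighbour \<open>x\<close> to be a
      zero too.\<close>
    have "U y \<noteq> 0"
    proof
      assume "U y = 0"
      then have "U x = 0"
        using neighbours_eq_0[where u = U and z = y and y = x, OF p pos(2) _ _ _ U_nonneg _ _ test]
          a k_pos \<open>G > 0\<close> \<open>adj x y\<close> by (simp add: adj_commute)
      with \<open>0 < U x\<close> show False
        by simp
    qed
    then show "0 < U y"
      using U_nonneg[of y] by simp
  qed (use \<open>\<delta> \<le> U 0\<close> \<delta>(1) in simp)
  define b where "b = k * G powr (1 / q - 1)"
  have "is_solution p q a b U"
    unfolding is_solution_def
  proof
    fix x
    have "U x powr (s - 2) * U x = U x powr (s - 1)" for s
      using powr_add[of "U x" "s - 2" 1] U_pos[of x] by simp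
    then show "- laplacian U x + a * \<bar>U x\<bar> powr (p - 2) * U x - b * \<bar>U x\<bar> powr (q - 2) * U x = 0"
      using one_point_Euler_Lagrange[where u = U and z = x, OF pos U_pos \<open>G > 0\<close> test] U_pos[of x]
      by (simp add: b_def mult.assoc)
  qed
  moreover have "b \<ge> a / p * R powr (p - q)"
  proof -
    \<comment> \<open>Since \<open>1 / q - 1\<close> is negative, the upper bound on
      \<open>G\<close> becomes a lower bound on \<open>b\<close>.\<close>
    have "R powr (1 - q) = (R powr q) powr (1 / q - 1)"
      using pos by (simp add: powr_powr algebra_simps)
    also have "\<dots> \<le> G powr (1 / q - 1)"
      using \<open>G > 0\<close> \<open>G \<le> R powr q\<close> p pq by (intro powr_mono2') auto
    finally have "k * R powr (1 - q) \<le> b"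
      using k_pos by (simp add: b_def)
    moreover have "k * R powr (1 - q) = a / p * R powr (p - q)"
      by (simp add: k_def mult.assoc flip: powr_add)
    ultimately show ?thesis
      by simp
  qed
  moreover have "U \<in> E_space p q"
  proof (rule E_space_I[OF pos U_nonneg])
    have sum: "(\<lambda>x. U x powr e) summable_on UNIV" if "e > 0" "\<And>n. pow_sum e (w n) \<le> C" for e C
    proof (rule summable_on_pointwise_limit)
      show "(\<lambda>n. \<bar>w n x\<bar> powr e) \<longlonglongrightarrow> U x powr e" for x
        using tendsto_powr'[OF tendsto_rabs[OF U[of x]] tendsto_const[of e]] \<open>e > 0\<close> U_nonneg[of x]
        by simp
      show "(\<Sum>x\<in>F. \<bar>w n x\<bar> powr e) \<le> C" if "finite F" for n F
        using sum_le_pow_sum[OF fs that, of "r (s n)" e] \<open>pow_sum e (w n) \<le> C\<close> by (simp add: w_def)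
    qed simp
    show "(\<lambda>x. U x powr p) summable_on UNIV"
      using sum[OF pos(1)] bounds(2) unfolding w_def by blast
    show "(\<lambda>x. U x powr q) summable_on UNIV"
      using sum[OF pos(2)] G_le unfolding w_def by blast
    show "(\<lambda>x. grad_length U x powr 2) summable_on UNIV"
    proof (rule summable_on_pointwise_limit)
      show "(\<lambda>n. grad_length (w n) x powr 2) \<longlonglongrightarrow> grad_length U x powr 2" for x
        unfolding grad_length_def
        by (intro tendsto_powr' tendsto_intros U) (auto intro!: always_eventually sum_nonneg)
      show "(\<Sum>x\<in>F. grad_length (w n) x powr 2) \<le> 2 * k * R" if "finite F" for n F
        using sum_grad_length_le_dirichlet[OF fs that, of "r (s n)"] bounds(3)[of "r (s n)"]
        by (simp add: w_def)
    qed simp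
  qed
  ultimately show ?thesis
    using that U_pos by blast
qed

end

section \<open>Unboundedness of the set of admissible coefficients\<close>

theorem theorem1p1:
  fixes p q a :: real
  assumes "CARD('n::finite) \<ge> 2" and "2 \<le> p" and "p < q" and "a > 0"
  shows "infinite {b :: real. b > 0 \<and>
           (\<exists>u :: int ^ 'n \<Rightarrow> real. u \<in> E_space p q \<and> (\<forall>x. u x > 0) \<and> is_solution p q a b u)}"
    (is "infinite ?B")
proof
  assume "finite ?B"
  then obtain M where M: "\<And>b. b \<in> ?B \<Longrightarrow> b \<le> M"
    using bdd_above_finite unfolding bdd_above_def by meson
  \<comment> \<open>\<open>K\<close> and \<open>R\<close> solve
    \<open>a / p * R powr (p - q) = \<bar>M\<bar> + 1\<close>, so the coefficient obtained for this
    \<open>R\<close> exceeds the supposed bound \<open>M\<close>.\<close>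
  define K where "K = (\<bar>M\<bar> + 1) * p / a"
  have "K > 0"
    using assms by (simp add: K_def)
  define R where "R = K powr (1 / (p - q))"
  have "R > 0" and RM: "a / p * R powr (p - q) = \<bar>M\<bar> + 1"
    using assms \<open>K > 0\<close> by (simp_all add: R_def powr_powr) (simp add: K_def)
  interpret lattice_parameters p q a R
    using assms \<open>R > 0\<close> by unfold_locales auto
  obtain u :: "int ^ 'n \<Rightarrow> real" and b where "u \<in> E_space p q" "\<And>x. u x > 0" "is_solution p q a b u"
      and b: "b \<ge> a / p * R powr (p - q)"
    using exists_positive_solution by blast
  moreover have "b > 0" "b > M"
    using b unfolding RM by linarith+
  ultimately show False
    using M[of b] by fastforce
qed

end
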